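(* Let $\phi$ be a greedy Fixer strategy in the Buster–Fixer game. Then $\phi$ is Fixer-dominant at every history $h\in\mathbb{H}^{B}$ (for every instance of the game, with every limit $\ell$).
   Context: **Game.** Multigraphs live on a fixed finite vertex set and are identified with their multisets of edges (all edges are regarded as distinct, even if they have the same endpoints); "connected" refers to the whole vertex set. An instance consists of a finite connected multigraph $G$, a finite multiset $R$ of reserve edges between vertices of $G$ with $G\cap R=\emptyset$, a finite weight $w(r)\ge 0$ for each $r\in R$ (with $w(R')=\sum_{r\in R'}w(r)$ for $R'\subseteq R$), and an integer $\ell\ge 0$ called the limit. Set $G_1=G$, $R_1=R$. Round $k$ ($k\ge1$) starts with a connected multigraph $G_k$ and a reserve set $R_k$. If $\sum_{j=1}^{k-1}|B_j|=\ell$, then Fixer wins in the $k$th round. Otherwise Buster chooses a nonempty $B_k\subseteq G_k$ with $\sum_{j=1}^{k}|B_j|\le \ell$. If $(G_k-B_k)\cup R_k$ is disconnected, then Buster wins in the $k$th round. Otherwise Fixer chooses $F_k\subseteq R_k$ (possibly empty) such that $(G_k-B_k)\cup F_k$ is connected, and one sets $G_{k+1}=(G_k-B_k)\cup F_k$, $R_{k+1}=R_k-F_k$, and play continues with round $k+1$. **Histories.** A history is a finite legal gameplay sequence $((G_1,R_1),B_1,F_1,(G_2,R_2),B_2,F_2,\ldots)$, implicitly endowed with the limit $\ell$ of the game. $\mathbb{H}^{B}_k$ is the set of histories ending with Buster's move $B_k$ in round $k$, and $\mathbb{H}^{B}=\bigcup_k\mathbb{H}^{B}_k$. $\mathbb{H}^{F}$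 is the set of histories awaiting Buster, i.e. ending with some $(G_k,R_k)$, $k\ge1$. For a history $h$ write $G^h_k,R^h_k,B^h_k,F^h_k$ for its round-$k$ data. A history is complete if Fixer or Buster has won; if the winner wins in round $k$, write $|h|=k$. (If Fixer wins in round $k$ the last entry is $(G_k,R_k)$; if Buster wins in round $k$ the last entry is $B_k$.) The Fixer payout of a complete history is $\pi(h)=1+w(R^h_{|h|})$ if Fixer wins, and $\pi(h)=-1-w(R^h_1-R^h_{|h|})$ if Buster wins. For complete histories $h,h'$ with the same limit, the same $G_1$ and the same $R_1$, $h$ is Fixer-superior to $h'$ if $\pi(h)\ge\pi(h')$. **Strategies.** A Buster strategy $\beta$ assigns to each non-complete $h\in\mathbb{H}^{F}$ a legal Buster move $\beta(h)$; a Fixer strategy $\phi$ assigns to each non-complete $h\in\mathbb{H}^{B}$ a legal Fixer move $\phi(h)$. For any history $h$, $h[\beta,\phi]$ is the complete history obtained by continuing $h$ with Buster playing by $\beta$ and Fixer by $\phi$ until someone wins (so it equals $h$ if $h$ is complete). **Dominance.** Fixer strategy $\phi$ Fixer-dominates Fixer strategy $\phi'$ at $h\in\mathbb{H}^{B}$ if for every Buster strategy $\beta$ there is a Buster strategy $\beta'$ such that $h[\beta,\phi]$ is Fixer-superior to $h[\beta',\phi']$. $\phi$ is Fixer-dominant at $h$ if it Fixer-dominates every other Fixer strategy at $h$. **Greedy.** A Fixer strategy $\phi$ is greedy if $w(\phi(h))\le w(\phi'(h))$ for every history $h\in\mathbb{H}^{B}$ at which Fixer has a move and every other Fixer strategy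 $\phi'$; that is, Fixer adds no reserve edge if the graph remains connected, and otherwise adds some cheapest set of reserve edges that reconnects it. *)

theory Defs
  imports Complex_Main "HOL-Library.While_Combinator"
begin

text \<open>
  Edges are labels of type \<open>'e\<close>, so parallel edges are distinct; a multigraph on the vertex
  set \<open>V\<close> is identified with its set of edges.  \<open>ends e\<close> is the set of endpoints of \<open>e\<close>,
  a singleton if \<open>e\<close> is a loop.

  \<open>Init l G R\<close> is the history \<open>((G, R))\<close> of a game with limit \<open>l\<close>.  \<open>Bust h B\<close> appends Buster's
  move \<open>B\<close>.  \<open>Fix h F\<close> appends both Fixer's move \<open>F\<close> and the position
  \<open>(G\<^sub>k\<^sub>+\<^sub>1, R\<^sub>k\<^sub>+\<^sub>1)\<close>, which is determined by \<open>h\<close> and \<open>F\<close> and hence not stored.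
\<close>

datatype 'e history =
    Init nat "'e set" "'e set"
  | Bust "'e history" "'e set"
  | Fix "'e history" "'e set"

primrec limit :: "'e history \<Rightarrow> nat" where
  "limit (Init l G R) = l"
| "limit (Bust h B) = limit h"
| "limit (Fix h F) = limit h"

primrec first_graph :: "'e history \<Rightarrow> 'e set" where
  "first_graph (Init l G R) = G"
| "first_graph (Bust h B) = first_graph h"
| "first_graph (Fix h F) = first_graph h"

primrec first_reserve :: "'e history \<Rightarrow> 'e set" where
  "first_reserve (Init l G R) = R"
| "first_reserve (Bust h B) = first_reserve h"
| "first_reserve (Fix h F) = first_reserve h"

primrec busted :: "'e history \<Rightarrow> nat" where
  "busted (Init l G R) = 0"
| "busted (Bust h B) = busted h + card B"
| "busted (Fix h F) = busted h"

text \<open>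
  For a history in round \<open>k\<close>, the following are \<open>G\<^sub>k\<close>, \<open>R\<^sub>k\<close>, and \<open>B\<^sub>k\<close>, where the last is
  \<open>{}\<close> if Buster has yet to move in round \<open>k\<close>.
\<close>

primrec last_bust :: "'e history \<Rightarrow> 'e set" where
  "last_bust (Init l G R) = {}"
| "last_bust (Bust h B) = B"
| "last_bust (Fix h F) = {}"

primrec graph :: "'e history \<Rightarrow> 'e set" where
  "graph (Init l G R) = G"
| "graph (Bust h B) = graph h"
| "graph (Fix h F) = (graph h - last_bust h) \<union> F"

primrec reserve :: "'e history \<Rightarrow> 'e set" where
  "reserve (Init l G R) = R"
| "reserve (Bust h B) = reserve h"
| "reserve (Fix h F) = reserve h - F"

primrec ends_with_bust :: "'e history \<Rightarrow> bool" where
  "ends_with_bust (Init l G R) = False"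
| "ends_with_bust (Bust h B) = True"
| "ends_with_bust (Fix h F) = False"

locale buster_fixer =
  fixes V :: "'v set" and ends :: "'e \<Rightarrow> 'v set" and w :: "'e \<Rightarrow> real"
  assumes finite_V: "finite V"
begin

definition conn :: "'e set \<Rightarrow> bool" where
  "conn E \<longleftrightarrow> (\<forall>u\<in>V. \<forall>v\<in>V. (u, v) \<in> {(x, y). \<exists>e\<in>E. ends e = {x, y}}\<^sup>*)"

definition game_instance :: "'e set \<Rightarrow> 'e set \<Rightarrow> bool" where
  "game_instance G R \<longleftrightarrow>
     finite G \<and> finite R \<and> G \<inter> R = {} \<and>
     (\<forall>e\<in>G \<union> R. \<exists>u\<in>V. \<exists>v\<in>V. ends e = {u, v}) \<and>
     (\<forall>r\<in>R. 0 \<le> w r) \<and> conn G"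

definition fixer_won :: "'e history \<Rightarrow> bool" where
  "fixer_won h \<longleftrightarrow> \<not> ends_with_bust h \<and> busted h = limit h"

definition buster_won :: "'e history \<Rightarrow> bool" where
  "buster_won h \<longleftrightarrow> ends_with_bust h \<and> \<not> conn ((graph h - last_bust h) \<union> reserve h)"

definition legal_bust :: "'e history \<Rightarrow> 'e set \<Rightarrow> bool" where
  "legal_bust h B \<longleftrightarrow> B \<noteq> {} \<and> B \<subseteq> graph h \<and> busted h + card B \<le> limit h"

definition legal_fix :: "'e history \<Rightarrow> 'e set \<Rightarrow> bool" where
  "legal_fix h F \<longleftrightarrow> F \<subseteq> reserve h \<and> conn ((graph h - last_bust h) \<union> F)"

text \<open>
  \<open>HF\<close> consists of the histories awaiting Buster (including those in which Fixer has just won),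
  \<open>HB\<close> of those ending with a move of Buster (including those in which this move wins).
\<close>

inductive_set HF :: "'e history set" and HB :: "'e history set" where
  Init: "game_instance G R \<Longrightarrow> Init l G R \<in> HF"
| Bust: "h \<in> HF \<Longrightarrow> \<not> fixer_won h \<Longrightarrow> legal_bust h B \<Longrightarrow> Bust h B \<in> HB"
| Fix: "h \<in> HB \<Longrightarrow> \<not> buster_won h \<Longrightarrow> legal_fix h F \<Longrightarrow> Fix h F \<in> HF"

definition game_over :: "'e history \<Rightarrow> bool" where
  "game_over h \<longleftrightarrow> fixer_won h \<or> buster_won h"

definition complete_history :: "'e history \<Rightarrow> bool" where
  "complete_history h \<longleftrightarrow> h \<in> HF \<union> HB \<and> game_over h"

definition payout :: "'e history \<Rightarrow> real" where
  "payout h = (if fixer_won h then 1 + sum w (reserve h)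
               else - 1 - sum w (first_reserve h - reserve h))"

definition fixer_superior :: "'e history \<Rightarrow> 'e history \<Rightarrow> bool" where
  "fixer_superior h h' \<longleftrightarrow>
     complete_history h \<and> complete_history h' \<and>
     limit h = limit h' \<and> first_graph h = first_graph h' \<and> first_reserve h = first_reserve h' \<and>
     payout h \<ge> payout h'"

definition buster_strategy :: "('e history \<Rightarrow> 'e set) \<Rightarrow> bool" where
  "buster_strategy \<beta> \<longleftrightarrow> (\<forall>h\<in>HF. \<not> game_over h \<longrightarrow> legal_bust h (\<beta> h))"

definition fixer_strategy :: "('e history \<Rightarrow> 'e set) \<Rightarrow> bool" where
  "fixer_strategy \<phi> \<longleftrightarrow> (\<forall>h\<in>HB. \<not> game_over h \<longrightarrow> legal_fix h (\<phi> h))"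

definition move :: "('e history \<Rightarrow> 'e set) \<Rightarrow> ('e history \<Rightarrow> 'e set) \<Rightarrow> 'e history \<Rightarrow> 'e history" where
  "move \<beta> \<phi> h = (if ends_with_bust h then Fix h (\<phi> h) else Bust h (\<beta> h))"

text \<open>
  \<open>play \<beta> \<phi> h\<close> is the continuation \<open>h[\<beta>,\<phi>]\<close>; the loop terminates whenever \<open>\<beta>\<close> and \<open>\<phi>\<close> are
  strategies (lemma \<open>complete_history_play\<close>).
\<close>

definition play :: "('e history \<Rightarrow> 'e set) \<Rightarrow> ('e history \<Rightarrow> 'e set) \<Rightarrow> 'e history \<Rightarrow> 'e history" where
  "play \<beta> \<phi> h = while (\<lambda>h. \<not> game_over h) (move \<beta> \<phi>) h"

definition fixer_dominates ::
    "('e history \<Rightarrow> 'e set) \<Rightarrow> ('e history \<Rightarrow> 'e set) \<Rightarrow> 'e history \<Rightarrow> bool" where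
  "fixer_dominates \<phi> \<phi>' h \<longleftrightarrow>
     (\<forall>\<beta>. buster_strategy \<beta> \<longrightarrow>
        (\<exists>\<beta>'. buster_strategy \<beta>' \<and> fixer_superior (play \<beta> \<phi> h) (play \<beta>' \<phi>' h)))"

definition fixer_dominant :: "('e history \<Rightarrow> 'e set) \<Rightarrow> 'e history \<Rightarrow> bool" where
  "fixer_dominant \<phi> h \<longleftrightarrow>
     (\<forall>\<phi>'. fixer_strategy \<phi>' \<and> \<phi>' \<noteq> \<phi> \<longrightarrow> fixer_dominates \<phi> \<phi>' h)"

definition greedy :: "('e history \<Rightarrow> 'e set) \<Rightarrow> bool" where
  "greedy \<phi> \<longleftrightarrow>
     (\<forall>h\<in>HB. \<not> game_over h \<longrightarrow>
        (\<forall>\<phi>'. fixer_strategy \<phi>' \<and> \<phi>' \<noteq> \<phi> \<longrightarrow> sum w (\<phi> h) \<le> sum w (\<phi>' h)))"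

lemma finite_graph:
  "h \<in> HF \<Longrightarrow> finite (graph h) \<and> finite (reserve h)"
  "h \<in> HB \<Longrightarrow> finite (graph h) \<and> finite (reserve h)"
  by (induction rule: HF_HB.inducts)
     (auto simp: game_instance_def legal_fix_def intro: finite_subset)

lemma move_history:
  assumes "buster_strategy \<beta>" "fixer_strategy \<phi>" "h \<in> HF \<union> HB" "\<not> game_over h"
  shows "move \<beta> \<phi> h \<in> HF \<union> HB"
proof -
  have "\<not> ends_with_bust h" if "h \<in> HF" using that by cases auto
  moreover have "ends_with_bust h" if "h \<in> HB" using that by cases auto
  ultimately show ?thesis
    using assms unfolding move_def buster_strategy_def fixer_strategy_def game_over_def
    by (auto intro: HF_HB.intros)
qed

lemma complete_history_play:
  assumes \<beta>: "buster_strategy \<beta>" and \<phi>: "fixer_strategy \<phi>" and h: "h \<in> HF \<union> HB"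
  shows "complete_history (play \<beta> \<phi> h)"
  unfolding play_def
proof (rule while_rule[where P = "\<lambda>h. h \<in> HF \<union> HB" and
      r = "measure (\<lambda>h. 2 * (limit h - busted h) + (if ends_with_bust h then 1 else 0))"])
  fix s assume s: "s \<in> HF \<union> HB" "\<not> game_over s"
  show "move \<beta> \<phi> s \<in> HF \<union> HB" using move_history[OF \<beta> \<phi> s] .
  show "(move \<beta> \<phi> s, s) \<in>
    measure (\<lambda>h. 2 * (limit h - busted h) + (if ends_with_bust h then 1 else 0))"
  proof (cases "ends_with_bust s")
    case False
    with s have "s \<in> HF" by (auto elim: HB.cases)
    with s \<beta> have "legal_bust s (\<beta> s)" by (auto simp: buster_strategy_def)
    moreover from this have "card (\<beta> s) > 0"
      using finite_graph(1)[OF \<open>s \<in> HF\<close>] unfolding legal_bust_def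
      by (metis card_gt_0_iff finite_subset)
    ultimately show ?thesis using False by (auto simp: move_def legal_bust_def)
  qed (auto simp: move_def)
qed (use h in \<open>auto simp: complete_history_def\<close>)

end

end

theory Submission
  imports Defs
begin

text \<open>
  A play costs Fixer the total weight of the reserve edges that he adds, and a large forfeit if he
  loses; his payout is a constant minus that cost. Since only finitely many plays are possible from
  a given position, domination amounts to comparing worst cases over Buster's strategies, and the
  proof computes this worst case explicitly.

  Suppose that Fixer plays greedily and that Buster has deleted the edges of \<open>D\<close>
  altogether without winning. If there are no ties between weights, then the current graph always
  contains a cheapest spanning subgraph of what is left, edges of \<open>G\<close> being free, as in
  Kruskal's algorithm. A reserve edge \<open>e\<close> is hence bought exactly if it is not spanned
  by the surviving edges that come before \<open>e\<close> when the edges of \<open>G\<close> are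
  listed first and the reserve edges follow by increasing weight. This condition makes sense for
  every \<open>D\<close>, whether or not it arises in a play; \<open>cost\<close> is the total
  weight of the edges that satisfy it. The potential of a position is the maximum, over all
  \<open>D\<close> that Buster can still afford, of this cost plus the forfeit if deleting
  \<open>D\<close> disconnects the union of graph and reserve. Instead of the maximum,
  \<open>attainable t\<close> records that some such \<open>D\<close> pushes the payout down to
  \<open>t\<close>.

  Greedy play never exceeds the potential: a cheapest reply \<open>F\<close> can be inserted into a
  sorted list of the other reserve edges without making any edge of \<open>F\<close> cheaper
  (\<open>cost_before_cheapest_reply\<close>). Thus the payout of a greedy play is attainable at its
  start (\<open>attainable_from_greedy_play\<close>).

  Conversely Buster can realise the potential against every Fixer. A reply \<open>F\<close> of Fixer
  amounts to moving the edges of \<open>F\<close> to the front of the sorted list, and the maximum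
  over \<open>D\<close> does not decrease in this process (\<open>cost_after_reply\<close>): if an
  edge \<open>b\<close> overtakes an edge \<open>a\<close> that is no heavier, the cost can only
  drop when \<open>a\<close> is deleted and \<open>b\<close> is the replacement for it, and then
  Buster deletes \<open>b\<close> instead of \<open>a\<close>. On his own moves Buster takes one
  edge of \<open>D\<close> that is in the graph, if there is any, postponing those that end the game
  (\<open>attainable_after_some_bust\<close>). So he attains against any other Fixer strategy at
  most the payout of the greedy play.

  Only the closure operator of the graphic matroid matters for the cost, so these lemmas are stated
  for an operator with the exchange property.
\<close>

section \<open>Deletion costs in a weighted matroid\<close>

locale weighted_closure =
  fixes cl :: "'e set \<Rightarrow> 'e set" and w :: "'e \<Rightarrow> real"
  assumes cl_extensive: "X \<subseteq> cl X"
    and cl_mono: "X \<subseteq> Y \<Longrightarrow> cl X \<subseteq> cl Y"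
    and cl_idem: "cl (cl X) = cl X"
    and cl_exchange: "y \<in> cl (insert x X) \<Longrightarrow> y \<notin> cl X \<Longrightarrow> x \<in> cl (insert y X)"
begin

lemma cl_subsetI: "X \<subseteq> cl Y \<Longrightarrow> cl X \<subseteq> cl Y"
  using cl_mono[of X "cl Y"] cl_idem by simp

lemma cl_eqI: "X \<subseteq> cl Y \<Longrightarrow> Y \<subseteq> cl X \<Longrightarrow> cl X = cl Y"
  by (simp add: cl_subsetI subset_antisym)

lemma cl_Un_cong: "cl X = cl Y \<Longrightarrow> cl (X \<union> Z) = cl (Y \<union> Z)"
  by (rule cl_eqI; use cl_extensive cl_mono in blast)

lemma cl_insert_absorb: "x \<in> cl X \<Longrightarrow> cl (insert x X) = cl X"
  by (rule cl_eqI; use cl_extensive cl_mono in blast)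

text \<open>
  \<open>P\<close> is the set of edges present, \<open>xs\<close> the edges that are on offer in this order, and \<open>D\<close> the set of
  edges that are going to be deleted.  An edge of \<open>D\<close> is paid for like any other edge,
  but is of no use to later ones.
\<close>

primrec cost :: "'e set \<Rightarrow> 'e set \<Rightarrow> 'e list \<Rightarrow> real" where
  "cost P D [] = 0"
| "cost P D (x # xs) = (if x \<in> cl P then 0 else w x) + cost (P \<union> ({x} - D)) D xs"

lemma cost_append: "cost P D (xs @ ys) = cost P D xs + cost (P \<union> (set xs - D)) D ys"
proof (induction xs arbitrary: P)
  case (Cons x xs)
  have "P \<union> ({x} - D) \<union> (set xs - D) = P \<union> (set (x # xs) - D)" by auto
  then show ?case using Cons[of "P \<union> ({x} - D)"] by simp
qed simp

lemma cost_cl_cong: "cl P = cl Q \<Longrightarrow> cost P D xs = cost Q D xs"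
proof (induction xs arbitrary: P Q)
  case (Cons x xs)
  show ?case using Cons.IH[OF cl_Un_cong[OF Cons.prems]] Cons.prems by simp
qed simp

lemma cost_deleted_cong: "D \<inter> set xs = D' \<inter> set xs \<Longrightarrow> cost P D xs = cost P D' xs"
proof (induction xs arbitrary: P)
  case (Cons x xs)
  then have "{x} - D = {x} - D'" "D \<inter> set xs = D' \<inter> set xs" by auto
  then show ?case using Cons.IH by simp
qed simp

lemma cost_nonneg: "\<forall>x\<in>set xs. 0 \<le> w x \<Longrightarrow> 0 \<le> cost P D xs"
  by (induction xs arbitrary: P) auto

lemma cost_le_sum:
  "distinct xs \<Longrightarrow> \<forall>x\<in>set xs. 0 \<le> w x \<Longrightarrow> cost P D xs \<le> sum w (set xs)"
  by (induction xs arbitrary: P) (auto intro: add_mono add_increasing)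

lemma cost_antimono:
  "P \<subseteq> Q \<Longrightarrow> \<forall>x\<in>set xs. 0 \<le> w x \<Longrightarrow> cost Q D xs \<le> cost P D xs"
proof (induction xs arbitrary: P Q)
  case (Cons x xs)
  have "cost (Q \<union> ({x} - D)) D xs \<le> cost (P \<union> ({x} - D)) D xs"
    using Cons.prems by (intro Cons.IH) auto
  then show ?case using Cons.prems cl_mono[of P Q] by auto
qed simp

lemma cost_spanned: "set xs \<subseteq> cl P \<Longrightarrow> cost P D xs = 0"
proof (induction xs arbitrary: P)
  case (Cons x xs)
  have "set xs \<subseteq> cl (P \<union> ({x} - D))" using Cons.prems cl_mono[of P "P \<union> ({x} - D)"] by auto
  then show ?case using Cons by simp
qed simp

text \<open>
  Buster changes his mind within \<open>S\<close>: he deletes \<open>D'\<close> in place of \<open>D\<close>, which costs him the same number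
  of deletions and leaves surviving edges with the same closure, so that neither the
  connectivity at the end nor the price of edges listed after \<open>S\<close> is affected.
\<close>

definition trade :: "'e set \<Rightarrow> 'e set \<Rightarrow> 'e set \<Rightarrow> 'e set \<Rightarrow> bool" where
  "trade P S D D' \<longleftrightarrow>
     finite D' \<and> card D' = card D \<and> D' - S = D - S \<and> cl (P \<union> (S - D')) = cl (P \<union> (S - D))"

lemma trade_trans: "trade P S D D' \<Longrightarrow> trade P S D' D'' \<Longrightarrow> trade P S D D''"
  by (simp add: trade_def)

lemma trade_insert:
  assumes "trade (P \<union> ({y} - D)) S D D'" "y \<notin> S"
  shows "trade P (insert y S) D D'"
proof -
  have y: "y \<in> D' \<longleftrightarrow> y \<in> D" using assms by (auto simp: trade_def)
  have "P \<union> (insert y S - A) = P \<union> ({y} - A) \<union> (S - A)" for A by auto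
  moreover have "{y} - D' = {y} - D" using y by auto
  ultimately show ?thesis using assms by (auto simp: trade_def)
qed

lemma trade_superset:
  assumes "trade P S D D'" "S \<subseteq> T"
  shows "trade P T D D'"
proof -
  have "P \<union> (T - A) = P \<union> (S - A) \<union> (T - S - A)" for A using assms(2) by auto
  moreover have "T - S - D' = T - S - D" using assms by (auto simp: trade_def)
  ultimately have "cl (P \<union> (T - D')) = cl (P \<union> (T - D))"
    using assms(1) cl_Un_cong unfolding trade_def by metis
  then show ?thesis using assms by (auto simp: trade_def)
qed

text \<open>
  Offering \<open>a\<close> and \<open>b\<close> in the other order affects what is paid only if they are parallel over \<open>P\<close>.
  In that case the edge listed first is always paid, and the other one is paid exactly if the
  first one is deleted.  If just \<open>a\<close> is deleted, both are paid when \<open>a\<close> is first; deleting \<open>b\<close>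
  instead has this effect in the other order.
\<close>

lemma cost_swap:
  assumes "finite D" "a \<noteq> b" "a \<notin> set xs" "b \<notin> set xs" "w a \<le> w b" "0 \<le> w a"
  shows "\<exists>D'. trade P {a, b} D D' \<and> cost P D (a # b # xs) \<le> cost P D' (b # a # xs)"
proof -
  have triv: "trade P {a, b} D D" using assms by (simp add: trade_def)
  have tail: "P \<union> ({a} - D) \<union> ({b} - D) = P \<union> ({b} - D) \<union> ({a} - D)" by auto
  \<comment> \<open>the case distinction is whether \<open>a\<close> and \<open>b\<close> are parallel over \<open>P\<close>\<close>
  show ?thesis
  proof (cases "a \<notin> cl P \<and> b \<notin> cl P \<and> b \<in> cl (insert a P)")
    case False
    have ab: "a \<in> cl P" if "a \<in> cl (insert b P)"
      using False that cl_exchange[of a b P] cl_insert_absorb[of b P] by blast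
    have ba: "b \<in> cl P" if "b \<in> cl (insert a P)"
      using False that cl_insert_absorb[of a P] by blast
    have "a \<in> cl (P \<union> ({b} - D)) \<longleftrightarrow> a \<in> cl P"
      using ab cl_mono[of P "insert b P"] by (cases "b \<in> D") (auto simp: insert_Diff_if)
    moreover have "b \<in> cl (P \<union> ({a} - D)) \<longleftrightarrow> b \<in> cl P"
      using ba cl_mono[of P "insert a P"] by (cases "a \<in> D") (auto simp: insert_Diff_if)
    ultimately have "cost P D (a # b # xs) = cost P D (b # a # xs)"
      by (simp only: cost.simps tail)
    then show ?thesis using triv by auto
  next
    case True
    then have par: "a \<notin> cl P" "b \<notin> cl P" "b \<in> cl (insert a P)" "a \<in> cl (insert b P)"
      using cl_exchange by auto
    have swap: "cl (insert a P) = cl (insert b P)"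
      using par cl_extensive[of "insert a P"] cl_extensive[of "insert b P"] by (intro cl_eqI) auto
    show ?thesis
    proof (cases "a \<in> D \<and> b \<notin> D")
      case False
      then have "cost P D (a # b # xs) \<le> cost P D (b # a # xs)"
        using par assms by (cases "a \<in> D"; cases "b \<in> D") (simp_all add: insert_commute insert_Diff_if)
      then show ?thesis using triv by auto
    next
      case True
      \<comment> \<open>only here does Buster have to revise his plan\<close>
      let ?D = "insert b (D - {a})"
      have "card ?D = card D"
        using True \<open>finite D\<close> card.remove[of D a] by simp
      moreover have "{a, b} - ?D = {a}" "{a, b} - D = {b}" using True \<open>a \<noteq> b\<close> by auto
      ultimately have "trade P {a, b} D ?D" using \<open>finite D\<close> swap by (auto simp: trade_def)
      moreover have "cost (insert b P) D xs = cost (insert a P) ?D xs"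
      proof -
        have "D \<inter> set xs = ?D \<inter> set xs" using assms by auto
        then show ?thesis using cost_cl_cong[OF swap] cost_deleted_cong[of D xs ?D] by simp
      qed
      ultimately show ?thesis using True par \<open>a \<noteq> b\<close> by (intro exI[of _ ?D]) (simp add: insert_Diff_if)
    qed
  qed
qed

lemma cost_move:
  assumes "finite D" "distinct (x # fs @ rs)" "\<forall>y\<in>set fs. w x \<le> w y" "0 \<le> w x"
  shows "\<exists>D'. trade P (set (x # fs)) D D' \<and> cost P D (x # fs @ rs) \<le> cost P D' (fs @ x # rs)"
  using assms
proof (induction fs arbitrary: P D)
  case Nil
  then show ?case by (auto simp: trade_def)
next
  case (Cons y ys)
  obtain D\<^sub>1 where D1: "trade P {x, y} D D\<^sub>1"
    "cost P D (x # y # ys @ rs) \<le> cost P D\<^sub>1 (y # x # ys @ rs)"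
    using cost_swap[of D x y "ys @ rs" P] Cons.prems by auto
  let ?P = "P \<union> ({y} - D\<^sub>1)"
  obtain D\<^sub>2 where D2: "trade ?P (set (x # ys)) D\<^sub>1 D\<^sub>2"
    "cost ?P D\<^sub>1 (x # ys @ rs) \<le> cost ?P D\<^sub>2 (ys @ x # rs)"
    using Cons.IH[of D\<^sub>1 ?P] Cons.prems D1(1) by (auto simp: trade_def)
  have y: "y \<in> D\<^sub>2 \<longleftrightarrow> y \<in> D\<^sub>1"
    using D2(1) Cons.prems(2) by (auto simp: trade_def)
  have "trade P (set (x # y # ys)) D D\<^sub>1"
    using D1(1) by (rule trade_superset) auto
  moreover have "trade P (insert y (set (x # ys))) D\<^sub>1 D\<^sub>2"
    using D2(1) Cons.prems(2) by (intro trade_insert) auto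
  then have "trade P (set (x # y # ys)) D\<^sub>1 D\<^sub>2" by (simp add: insert_commute)
  ultimately have "trade P (set (x # y # ys)) D D\<^sub>2" by (rule trade_trans)
  moreover have "{y} - D\<^sub>2 = {y} - D\<^sub>1" using y by auto
  then have "cost P D\<^sub>1 (y # x # ys @ rs) \<le> cost P D\<^sub>2 (y # ys @ x # rs)"
    using D2(2) by simp
  ultimately show ?case using D1(2) by fastforce
qed

text \<open>
  In a sorted list, every edge outside \<open>F\<close> that precedes an edge of \<open>F\<close> is at most as heavy, so that
  \<open>F\<close> can be brought to the front by exchanges of the kind treated in \<open>cost_swap\<close>.
\<close>

lemma cost_partition:
  assumes "finite D" "distinct xs" "sorted (map w xs)" "\<forall>x\<in>set xs. 0 \<le> w x"
  shows "\<exists>D'. trade P (set xs) D D' \<and>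
    cost P D xs \<le> cost P D' (filter (\<lambda>x. x \<in> F) xs @ filter (\<lambda>x. x \<notin> F) xs)"
  using assms
proof (induction xs arbitrary: P D)
  case Nil
  then show ?case by (auto simp: trade_def)
next
  case (Cons x xs)
  let ?P = "P \<union> ({x} - D)"
  let ?f = "filter (\<lambda>x. x \<in> F) xs" and ?r = "filter (\<lambda>x. x \<notin> F) xs"
  obtain D\<^sub>1 where D1: "trade ?P (set xs) D D\<^sub>1" "cost ?P D xs \<le> cost ?P D\<^sub>1 (?f @ ?r)"
    using Cons.IH[of D ?P] Cons.prems by auto
  have x: "x \<in> D\<^sub>1 \<longleftrightarrow> x \<in> D" using D1(1) Cons.prems(2) by (auto simp: trade_def)
  have t1: "trade P (set (x # xs)) D D\<^sub>1"
    using trade_insert[OF D1(1)] Cons.prems(2) by simp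
  have "{x} - D\<^sub>1 = {x} - D" using x by auto
  then have c1: "cost P D (x # xs) \<le> cost P D\<^sub>1 (x # ?f @ ?r)" using D1(2) by simp
  show ?case
  proof (cases "x \<in> F")
    case True
    then show ?thesis using t1 c1 by auto
  next
    case False
    obtain D\<^sub>2 where D2: "trade P (set (x # ?f)) D\<^sub>1 D\<^sub>2"
      "cost P D\<^sub>1 (x # ?f @ ?r) \<le> cost P D\<^sub>2 (?f @ x # ?r)"
      using cost_move[of D\<^sub>1 x ?f ?r P] Cons.prems t1 by (auto simp: trade_def)
    have "trade P (set (x # xs)) D\<^sub>1 D\<^sub>2" using D2(1) by (rule trade_superset) auto
    then have "trade P (set (x # xs)) D D\<^sub>2" using t1 trade_trans by blast
    then show ?thesis using c1 D2(2) False by fastforce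
  qed
qed

text \<open>
  If Fixer replies with \<open>F\<close>, Buster can revise his plan \<open>D\<close> to a plan \<open>D'\<close> that is as good for
  the new position: bring \<open>F\<close> to the front of the list, where its edges cost at most \<open>sum w F\<close>.
\<close>

lemma cost_after_reply:
  assumes fin: "finite D" and xs: "distinct xs" "sorted (map w xs)" "\<forall>x\<in>set xs. 0 \<le> w x"
    and F: "F \<subseteq> set xs" and H: "H \<inter> set xs = {}" and D: "D \<subseteq> H \<union> set xs"
  shows "\<exists>D'. D' \<subseteq> H \<union> set xs \<and> card D' = card D \<and>
    cl (H \<union> set xs - D') = cl (H \<union> set xs - D) \<and>
    cost (H - D) D xs \<le> sum w F + cost (H \<union> F - D') D' (filter (\<lambda>x. x \<notin> F) xs)"
proof -
  let ?f = "filter (\<lambda>x. x \<in> F) xs" and ?r = "filter (\<lambda>x. x \<notin> F) xs"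
  obtain D' where D': "trade (H - D) (set xs) D D'" "cost (H - D) D xs \<le> cost (H - D) D' (?f @ ?r)"
    using cost_partition[OF fin xs] by blast
  have out: "D' - set xs = D - set xs" using D'(1) by (simp add: trade_def)
  then have HD: "H - D = H - D'" using H by blast
  have f: "set ?f = F" using F by auto
  have "cost (H - D) D' ?f \<le> sum w F"
    using cost_le_sum[of ?f "H - D" D'] xs f by auto
  moreover have "H - D \<union> (F - D') = H \<union> F - D'" using HD by auto
  ultimately have "cost (H - D) D xs \<le> sum w F + cost (H \<union> F - D') D' ?r"
    using D'(2) f by (simp add: cost_append)
  moreover have "H - D \<union> (set xs - A) = H \<union> set xs - A" if "A \<in> {D, D'}" for A
    using HD that by auto
  then have "cl (H \<union> set xs - D') = cl (H \<union> set xs - D)"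
    using D'(1) by (auto simp: trade_def)
  ultimately show ?thesis using D'(1) out D by (intro exI[of _ D']) (auto simp: trade_def)
qed

text \<open>
  An edge \<open>f\<close> that was bought in advance is equally expensive in its sorted position, provided that
  the lighter edges do not span it, and the other edges do not get cheaper
  if \<open>f\<close> comes later.
\<close>

lemma cost_insort:
  assumes "w f = 0 \<or> f \<notin> cl (P \<union> {y \<in> set ys. w y < w f})" "\<forall>y\<in>set ys. 0 \<le> w y"
  shows "w f + cost (P \<union> ({f} - D)) D ys \<le> cost P D (insort_key w f ys)"
  using assms
proof (induction ys arbitrary: P)
  case Nil
  then show ?case by auto
next
  case (Cons y ys)
  show ?case
  proof (cases "w f \<le> w y")
    case True
    have "w f = 0 \<or> f \<notin> cl P"
      using Cons.prems(1) cl_mono[of P "P \<union> {z \<in> set (y # ys). w z < w f}"] by auto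
    then show ?thesis using True by auto
  next
    case False
    have sub: "P \<union> ({y} - D) \<union> {z \<in> set ys. w z < w f} \<subseteq> P \<union> {z \<in> set (y # ys). w z < w f}"
      using False by auto
    have "w f + cost (P \<union> ({y} - D) \<union> ({f} - D)) D ys \<le> cost (P \<union> ({y} - D)) D (insort_key w f ys)"
      using Cons.prems cl_mono[OF sub] by (intro Cons.IH) auto
    moreover have "P \<union> ({y} - D) \<union> ({f} - D) = P \<union> ({f} - D) \<union> ({y} - D)" by auto
    moreover have "cl P \<subseteq> cl (P \<union> ({f} - D))" by (simp add: cl_mono)
    ultimately show ?thesis using False Cons.prems(2) by auto
  qed
qed

text \<open>
  If lighter edges helped to span \<open>f\<close>, one of them could replace \<open>f\<close> in \<open>F\<close>, by the exchange
  property.  Edges of weight \<open>0\<close> are exempt because a cheapest set may contain superfluous ones.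
\<close>

lemma cheapest_not_spanned:
  assumes fin: "finite R" and nonneg: "\<forall>r\<in>R. 0 \<le> w r" and F: "F \<subseteq> R" "H \<union> R \<subseteq> cl (H \<union> F)"
    and min: "\<And>F'. F' \<subseteq> R \<Longrightarrow> H \<union> R \<subseteq> cl (H \<union> F') \<Longrightarrow> sum w F \<le> sum w F'"
    and f: "f \<in> F" "w f \<noteq> 0"
  shows "f \<notin> cl (H \<union> (F - {f}) \<union> {r \<in> R. w r < w f})"
proof
  let ?X = "H \<union> (F - {f})" and ?Y = "{r \<in> R. w r < w f}"
  assume dep: "f \<in> cl (?X \<union> ?Y)"
  have wf: "w f > 0" using f F nonneg by force
  have finF: "finite F" using F fin finite_subset by blast
  have sumF: "sum w F = w f + sum w (F - {f})" using finF f by (simp add: sum.remove)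
  have Xf: "insert f ?X = H \<union> F" using f by auto
  have "f \<notin> cl ?X"
  proof
    assume "f \<in> cl ?X"
    then have "cl (H \<union> F) = cl ?X" using cl_insert_absorb[of f ?X] Xf by simp
    then have "sum w F \<le> sum w (F - {f})" using F by (intro min) auto
    then show False using sumF wf by simp
  qed
  moreover have "f \<in> cl ?X" if "?Y \<subseteq> cl ?X"
    using that dep cl_extensive[of ?X] cl_subsetI[of "?X \<union> ?Y" ?X] by blast
  \<comment> \<open>if all lighter edges were spanned by the rest, so would be \<open>f\<close>\<close>
  ultimately obtain y where y: "y \<in> R" "w y < w f" "y \<notin> cl ?X" by auto
  have "y \<in> cl (insert f ?X)" using y F Xf by auto
  then have "f \<in> cl (insert y ?X)" using y cl_exchange by blast
  then have "H \<union> F \<subseteq> cl (insert y ?X)"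
    using cl_extensive[of "insert y ?X"] by blast
  then have "H \<union> R \<subseteq> cl (insert y ?X)" using F cl_subsetI by blast
  then have "sum w F \<le> sum w (insert y (F - {f}))" using F y by (intro min) auto
  also have "\<dots> = w y + sum w (F - {f})"
    using finF y cl_extensive[of ?X] by (subst sum.insert) auto
  finally show False using sumF y by simp
qed

text \<open>
  The edges of a cheapest reply \<open>F\<close>, inserted one at a time into a sorted list of the remaining
  reserve edges, give a sorted list for which the plan \<open>D\<close> is worth at least as much to Buster
  before the reply as after it, with the price of \<open>F\<close> included.
\<close>

lemma cost_before_cheapest_reply:
  assumes fin: "finite R" and nonneg: "\<forall>r\<in>R. 0 \<le> w r" and F: "F \<subseteq> R" "H \<union> R \<subseteq> cl (H \<union> F)"
    and min: "\<And>F'. F' \<subseteq> R \<Longrightarrow> H \<union> R \<subseteq> cl (H \<union> F') \<Longrightarrow> sum w F \<le> sum w F'"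
    and xs: "distinct xs" "sorted (map w xs)" "set xs = R - F"
  shows "\<exists>ys. distinct ys \<and> sorted (map w ys) \<and> set ys = R \<and>
    sum w F + cost (H \<union> F - D) D xs \<le> cost (H - D) D ys"
proof -
  \<comment> \<open>\<open>A\<close> collects the edges already inserted; those of \<open>F - A\<close> still count as present\<close>
  have "\<exists>ys. distinct ys \<and> sorted (map w ys) \<and> set ys = (R - F) \<union> A \<and>
    sum w A + cost (H \<union> F - D) D xs \<le> cost (H \<union> (F - A) - D) D ys" if "A \<subseteq> F" for A
  proof -
    have "finite A" using finite_subset[OF subset_trans[OF that F(1)] fin] .
    then show ?thesis using that
    proof (induction A)
      case empty
      then show ?case using xs by auto
    next
      case (insert f A)
      then obtain ys where ys: "distinct ys" "sorted (map w ys)" "set ys = (R - F) \<union> A"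
        "sum w A + cost (H \<union> F - D) D xs \<le> cost (H \<union> (F - A) - D) D ys" by auto
      let ?P = "H \<union> (F - insert f A) - D"
      have f: "f \<in> F" "f \<notin> A" using insert by auto
      have sub: "?P \<union> {y \<in> set ys. w y < w f} \<subseteq> H \<union> (F - {f}) \<union> {r \<in> R. w r < w f}"
        using ys(3) F insert.prems by auto
      have "w f = 0 \<or> f \<notin> cl (?P \<union> {y \<in> set ys. w y < w f})"
        using cheapest_not_spanned[OF fin nonneg F min f(1)] cl_mono[OF sub] by blast
      then have "w f + cost (?P \<union> ({f} - D)) D ys \<le> cost ?P D (insort_key w f ys)"
        using nonneg ys(3) F insert.prems by (intro cost_insort) auto
      moreover have "cost (H \<union> (F - A) - D) D ys \<le> cost (?P \<union> ({f} - D)) D ys"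
        using nonneg ys(3) F f insert.prems by (intro cost_antimono) auto
      ultimately have "sum w (insert f A) + cost (H \<union> F - D) D xs \<le> cost ?P D (insort_key w f ys)"
        using ys(4) insert.hyps by simp
      moreover have "distinct (insort_key w f ys)"
        using ys f by (simp add: distinct_insort)
      moreover have "set (insort_key w f ys) = (R - F) \<union> insert f A"
        using ys(3) by (simp add: set_insort_key)
      ultimately show ?case using ys(2) by (intro exI[of _ "insort_key w f ys"]) (simp add: sorted_insort_key)
    qed
  qed
  from this[of F] show ?thesis using F by (auto simp: Un_absorb2)
qed

end

section \<open>Connectivity as a closure operator\<close>

context buster_fixer
begin

definition adj :: "'e set \<Rightarrow> ('v \<times> 'v) set" where
  "adj X = {(x, y). \<exists>e\<in>X. ends e = {x, y}}"

text \<open>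
  This is the closure operator of the graphic matroid.  A label whose set of endpoints is not
  of the form \<open>{u, v}\<close> lies in every closure, so that the closure axioms hold on the whole type.
\<close>

definition graphic_closure :: "'e set \<Rightarrow> 'e set" where
  "graphic_closure X = {e. \<forall>u v. ends e = {u, v} \<longrightarrow> (u, v) \<in> (adj X)\<^sup>*}"

lemma adj_sym: "(x, y) \<in> (adj X)\<^sup>* \<Longrightarrow> (y, x) \<in> (adj X)\<^sup>*"
proof -
  have "sym (adj X)" by (auto simp: sym_def adj_def insert_commute)
  then show "(x, y) \<in> (adj X)\<^sup>* \<Longrightarrow> (y, x) \<in> (adj X)\<^sup>*"
    using sym_rtrancl by (metis symD)
qed

lemma adj_mono: "X \<subseteq> Y \<Longrightarrow> adj X \<subseteq> adj Y"
  by (auto simp: adj_def)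

text \<open>
  A path that joins the ends of \<open>f\<close> and uses \<open>e = {a, b}\<close> becomes, with \<open>e\<close> replaced by \<open>f\<close>, a path
  that joins \<open>a\<close> and \<open>b\<close>.
\<close>

lemma graphic_closure_exchange:
  assumes "f \<in> graphic_closure (insert e X)" "f \<notin> graphic_closure X"
  shows "e \<in> graphic_closure (insert f X)"
proof -
  obtain u v where uv: "ends f = {u, v}" "(u, v) \<notin> (adj X)\<^sup>*" "(u, v) \<in> (adj (insert e X))\<^sup>*"
    using assms by (auto simp: graphic_closure_def)
  have "(a, b) \<in> (adj (insert f X))\<^sup>*" if ab: "ends e = {a, b}" for a b
  proof -
    have "adj (insert e X) = insert (a, b) (insert (b, a) (adj X))"
      using ab by (auto simp: adj_def doubleton_eq_iff)
    then have "(u, a) \<in> (adj X)\<^sup>* \<and> (b, v) \<in> (adj X)\<^sup>* \<or> (u, b) \<in> (adj X)\<^sup>* \<and> (a, v) \<in> (adj X)\<^sup>*"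
      using uv(2,3) adj_sym[of _ _ X] by (auto simp: rtrancl_insert dest: rtrancl_trans)
    moreover have "(x, y) \<in> (adj (insert f X))\<^sup>*" if "(x, y) \<in> (adj X)\<^sup>*" for x y
      using that rtrancl_mono[OF adj_mono[of X "insert f X"]] by auto
    moreover have "(u, v) \<in> (adj (insert f X))\<^sup>*"
      using uv(1) by (auto simp: adj_def)
    ultimately show ?thesis by (metis adj_sym rtrancl_trans)
  qed
  then show ?thesis by (auto simp: graphic_closure_def)
qed

lemma adj_graphic_closure: "(adj (graphic_closure X))\<^sup>* = (adj X)\<^sup>*"
proof
  have "adj (graphic_closure X) \<subseteq> (adj X)\<^sup>*" by (auto simp: adj_def graphic_closure_def)
  then show "(adj (graphic_closure X))\<^sup>* \<subseteq> (adj X)\<^sup>*" using rtrancl_subset_rtrancl by blast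
  have "adj X \<subseteq> adj (graphic_closure X)" by (rule adj_mono) (auto simp: graphic_closure_def adj_def)
  then show "(adj X)\<^sup>* \<subseteq> (adj (graphic_closure X))\<^sup>*" by (rule rtrancl_mono)
qed

sublocale weighted_closure graphic_closure w
proof
  show "X \<subseteq> graphic_closure X" for X by (auto simp: graphic_closure_def adj_def)
  show "graphic_closure X \<subseteq> graphic_closure Y" if "X \<subseteq> Y" for X Y
    using rtrancl_mono[OF adj_mono[OF that]] by (auto simp: graphic_closure_def)
  show "graphic_closure (graphic_closure X) = graphic_closure X" for X
    by (auto simp: graphic_closure_def[of "graphic_closure X"] adj_graphic_closure) (auto simp: graphic_closure_def)
  show "x \<in> graphic_closure (insert y X)"
    if "y \<in> graphic_closure (insert x X)" "y \<notin> graphic_closure X" for x y X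
    using graphic_closure_exchange that .
qed

lemma conn_adj: "conn X \<longleftrightarrow> (\<forall>u\<in>V. \<forall>v\<in>V. (u, v) \<in> (adj X)\<^sup>*)"
  by (simp add: conn_def adj_def)

lemma conn_mono: "X \<subseteq> Y \<Longrightarrow> conn X \<Longrightarrow> conn Y"
  unfolding conn_adj using rtrancl_mono[OF adj_mono] by blast

lemma conn_iff_closure:
  assumes "conn Y" "\<forall>e\<in>Y. \<exists>u\<in>V. \<exists>v\<in>V. ends e = {u, v}"
  shows "conn X \<longleftrightarrow> Y \<subseteq> graphic_closure X"
proof
  assume X: "conn X"
  show "Y \<subseteq> graphic_closure X"
  proof
    fix e assume "e \<in> Y"
    then obtain u v where "u \<in> V" "v \<in> V" "ends e = {u, v}" using assms(2) by blast
    then show "e \<in> graphic_closure X" using X by (auto simp: graphic_closure_def conn_adj doubleton_eq_iff)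
  qed
next
  assume "Y \<subseteq> graphic_closure X"
  then have "conn (graphic_closure X)" using assms(1) conn_mono by blast
  then show "conn X" by (simp add: conn_adj adj_graphic_closure)
qed

section \<open>The potential of a position\<close>

text \<open>
  The graph that Fixer has to reconnect if he is to move; if Buster is to move, the current graph.
\<close>

definition kept :: "'e history \<Rightarrow> 'e set" where
  "kept h = graph h - last_bust h"

text \<open>
  \<open>D\<close> is Buster's plan: the edges he still intends to delete.  The list \<open>xs\<close> is quantified because
  edges of equal weight may be sorted in several ways.  The forfeit is the difference between the
  two kinds of payout at equal remaining reserve, see \<open>payout_eq\<close>.
\<close>

definition attainable :: "real \<Rightarrow> 'e history \<Rightarrow> bool" where
  "attainable t h \<longleftrightarrow> (\<exists>D xs. D \<subseteq> kept h \<union> reserve h \<and> card D + busted h \<le> limit h \<and>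
     distinct xs \<and> sorted (map w xs) \<and> set xs = reserve h \<and>
     1 + sum w (reserve h) - cost (kept h - D) D xs
       - (if conn (kept h \<union> reserve h - D) then 0 else 2 + sum w (first_reserve h)) \<le> t)"

lemma history_kind:
  "h \<in> HF \<Longrightarrow> \<not> ends_with_bust h \<and> last_bust h = {}"
  "h \<in> HB \<Longrightarrow> ends_with_bust h"
  by (auto elim: HF.cases HB.cases)

definition sound :: "'e history \<Rightarrow> bool" where
  "sound h \<longleftrightarrow> finite (graph h) \<and> finite (first_reserve h) \<and> reserve h \<subseteq> first_reserve h \<and>
     graph h \<inter> reserve h = {} \<and> last_bust h \<subseteq> graph h \<and> busted h \<le> limit h \<and> conn (graph h) \<and>
     (\<forall>e\<in>graph h \<union> reserve h. \<exists>u\<in>V. \<exists>v\<in>V. ends e = {u, v}) \<and> (\<forall>r\<in>first_reserve h. 0 \<le> w r)"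

lemma history_sound:
  "h \<in> HF \<Longrightarrow> sound h"
  "h \<in> HB \<Longrightarrow> sound h"
proof (induction rule: HF_HB.inducts)
  case (Init G R l)
  then show ?case by (auto simp: game_instance_def sound_def)
next
  case (Bust h B)
  then show ?case by (auto simp: legal_bust_def sound_def)
next
  case (Fix h F)
  then have F: "F \<subseteq> reserve h" "conn (graph h - last_bust h \<union> F)" by (auto simp: legal_fix_def)
  then have "finite F" using Fix.IH by (meson finite_subset sound_def)
  then show ?case using Fix.IH F by (auto simp: sound_def)
qed

lemma sound_reserve:
  assumes "sound h"
  shows "finite (reserve h)" "\<forall>r\<in>reserve h. 0 \<le> w r" "0 \<le> sum w (first_reserve h)"
  using assms by (auto simp: sound_def intro: finite_subset sum_nonneg)

lemma sorted_reserve: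
  assumes "sound h"
  obtains xs where "distinct xs" "sorted (map w xs)" "set xs = reserve h"
proof -
  obtain ys where "distinct ys" "set ys = reserve h"
    using finite_distinct_list sound_reserve(1)[OF assms] by blast
  then show ?thesis using that[of "sort_key w ys"] by simp
qed

lemma payout_eq:
  assumes "sound h"
  shows "payout h =
    1 + sum w (reserve h) - (if fixer_won h then 0 else 2 + sum w (first_reserve h))"
proof -
  have "sum w (first_reserve h - reserve h) = sum w (first_reserve h) - sum w (reserve h)"
    using assms by (intro sum_diff) (auto simp: sound_def)
  then show ?thesis by (simp add: payout_def)
qed

lemma kept_eq_graph: "h \<in> HF \<Longrightarrow> kept h = graph h"
  by (simp add: kept_def history_kind)

lemma reserve_spanned:
  assumes "sound h"
  shows "reserve h \<subseteq> graphic_closure (graph h)"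
proof -
  have "conn (graph h \<union> reserve h)" using assms conn_mono[of "graph h"] by (simp add: sound_def)
  then have "graph h \<union> reserve h \<subseteq> graphic_closure (graph h)"
    using assms conn_iff_closure[of "graph h \<union> reserve h" "graph h"] by (simp add: sound_def)
  then show ?thesis by simp
qed

text \<open>
  When the game is over, the empty plan yields the actual payout or less.
\<close>

lemma complete_attainable:
  assumes "complete_history h"
  shows "attainable (payout h) h"
proof -
  have h: "sound h" using assms history_sound by (auto simp: complete_history_def)
  obtain xs where xs: "distinct xs" "sorted (map w xs)" "set xs = reserve h"
    using sorted_reserve[OF h] .
  have "0 \<le> cost (kept h) {} xs" using xs(3) sound_reserve[OF h] by (intro cost_nonneg) simp
  moreover have "\<not> conn (kept h \<union> reserve h)" if "\<not> fixer_won h"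
    using that assms by (auto simp: complete_history_def game_over_def buster_won_def kept_def)
  ultimately show ?thesis
    unfolding attainable_def using h xs payout_eq[OF h] sound_reserve(3)[OF h]
    by (intro exI[of _ "{}"] exI[of _ xs]) (auto simp: sound_def)
qed

lemma attainable_before_bust:
  assumes h: "h \<in> HF" and B: "legal_bust h B" and att: "attainable t (Bust h B)"
  shows "attainable t h"
proof -
  note s = history_sound(1)[OF h]
  have BG: "B \<subseteq> graph h" "B \<inter> reserve h = {}" "card B + busted h \<le> limit h" "last_bust h = {}"
    using B s history_kind(1)[OF h] by (auto simp: legal_bust_def sound_def)
  from att obtain D xs where D: "D \<subseteq> graph h - B \<union> reserve h" "card D + (busted h + card B) \<le> limit h"
    and xs: "distinct xs" "sorted (map w xs)" "set xs = reserve h"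
    and le: "1 + sum w (reserve h) - cost (graph h - B - D) D xs
       - (if conn (graph h - B \<union> reserve h - D) then 0 else 2 + sum w (first_reserve h)) \<le> t"
    by (auto simp: attainable_def kept_def cong: if_cong)
  have "D \<inter> set xs = (B \<union> D) \<inter> set xs" using BG xs by auto
  then have "cost (graph h - B - D) D xs = cost (graph h - (B \<union> D)) (B \<union> D) xs"
    using cost_deleted_cong[of D xs "B \<union> D"] by (simp add: set_diff_eq conj_commute conj_left_commute)
  moreover have "graph h - B \<union> reserve h - D = graph h \<union> reserve h - (B \<union> D)" using BG by auto
  moreover have "card (B \<union> D) \<le> card B + card D" by (rule card_Un_le)
  ultimately show ?thesis
    unfolding attainable_def kept_eq_graph[OF h] using D xs le BG
    by (intro exI[of _ "B \<union> D"] exI[of _ xs]) auto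
qed

lemma awaiting_fixer:
  assumes "h \<in> HB" "\<not> game_over h"
  shows "conn (kept h \<union> reserve h)"
    "\<forall>e\<in>kept h \<union> reserve h. \<exists>u\<in>V. \<exists>v\<in>V. ends e = {u, v}"
    "kept h \<inter> reserve h = {}"
    "conn X \<longleftrightarrow> kept h \<union> reserve h \<subseteq> graphic_closure X"
proof -
  show c: "conn (kept h \<union> reserve h)"
    using assms history_kind(2) by (auto simp: game_over_def buster_won_def kept_def)
  show e: "\<forall>e\<in>kept h \<union> reserve h. \<exists>u\<in>V. \<exists>v\<in>V. ends e = {u, v}"
    and "kept h \<inter> reserve h = {}"
    using history_sound(2)[OF assms(1)] by (auto simp: sound_def kept_def)
  show "conn X \<longleftrightarrow> kept h \<union> reserve h \<subseteq> graphic_closure X" using conn_iff_closure[OF c e] .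
qed

text \<open>
  Greediness compares \<open>\<phi>\<close> with strategies; a single legal move \<open>F\<close> is turned into a strategy by
  redefining \<open>\<phi>\<close> at \<open>h\<close>.
\<close>

lemma greedy_cheapest:
  assumes "fixer_strategy \<phi>" "greedy \<phi>" "h \<in> HB" "\<not> game_over h" "legal_fix h F"
  shows "sum w (\<phi> h) \<le> sum w F"
proof (cases "F = \<phi> h")
  case False
  then have "\<phi>(h := F) \<noteq> \<phi>" by (metis fun_upd_same)
  moreover have "fixer_strategy (\<phi>(h := F))" using assms by (auto simp: fixer_strategy_def)
  ultimately have "sum w (\<phi> h) \<le> sum w ((\<phi>(h := F)) h)"
    using assms(2-4) unfolding greedy_def by blast
  then show ?thesis by simp
qed simp

lemma attainable_before_greedy_fix:
  assumes \<phi>: "fixer_strategy \<phi>" "greedy \<phi>" and h: "h \<in> HB" "\<not> game_over h"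
    and att: "attainable t (Fix h (\<phi> h))"
  shows "attainable t h"
proof -
  define F where "F = \<phi> h"
  have legal: "legal_fix h F" using \<phi> h by (auto simp: fixer_strategy_def F_def)
  then have F: "F \<subseteq> reserve h" "kept h \<union> reserve h \<subseteq> graphic_closure (kept h \<union> F)"
    using awaiting_fixer(4)[OF h] by (auto simp: legal_fix_def kept_def)
  note R = sound_reserve[OF history_sound(2)[OF h(1)]]
  have min: "sum w F \<le> sum w F'"
    if "F' \<subseteq> reserve h" "kept h \<union> reserve h \<subseteq> graphic_closure (kept h \<union> F')" for F'
    unfolding F_def using that awaiting_fixer(4)[OF h]
    by (intro greedy_cheapest[OF \<phi> h]) (auto simp: legal_fix_def kept_def)
  from att obtain D xs where
    D: "D \<subseteq> (kept h \<union> F) \<union> (reserve h - F)" "card D + busted h \<le> limit h"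
    and xs: "distinct xs" "sorted (map w xs)" "set xs = reserve h - F"
    and le: "1 + sum w (reserve h - F) - cost (kept h \<union> F - D) D xs
       - (if conn (kept h \<union> F \<union> (reserve h - F) - D) then 0 else 2 + sum w (first_reserve h)) \<le> t"
    by (auto simp: attainable_def kept_def F_def cong: if_cong)
  obtain ys where ys: "distinct ys" "sorted (map w ys)" "set ys = reserve h"
    "sum w F + cost (kept h \<union> F - D) D xs \<le> cost (kept h - D) D ys"
    using cost_before_cheapest_reply[OF R(1,2) F min xs, of D] by blast
  have "sum w (reserve h - F) = sum w (reserve h) - sum w F"
    using R F by (simp add: sum_diff)
  moreover have "kept h \<union> F \<union> (reserve h - F) = kept h \<union> reserve h" using F by auto
  ultimately show ?thesis
    unfolding attainable_def using D ys le by (intro exI[of _ D] exI[of _ ys]) auto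
qed

lemma attainable_after_fix:
  assumes h: "h \<in> HB" "\<not> game_over h" and F: "legal_fix h F" and att: "attainable t h"
  shows "attainable t (Fix h F)"
proof -
  have FR: "F \<subseteq> reserve h" using F by (simp add: legal_fix_def)
  note s = history_sound(2)[OF h(1)]
  note R = sound_reserve[OF s]
  from att obtain D xs where D: "D \<subseteq> kept h \<union> reserve h" "card D + busted h \<le> limit h"
    and xs: "distinct xs" "sorted (map w xs)" "set xs = reserve h"
    and le: "1 + sum w (reserve h) - cost (kept h - D) D xs
       - (if conn (kept h \<union> reserve h - D) then 0 else 2 + sum w (first_reserve h)) \<le> t"
    by (auto simp: attainable_def)
  have "finite D" using D(1) s R(1) by (auto simp: sound_def kept_def intro: finite_subset)
  then obtain D' where D': "D' \<subseteq> kept h \<union> reserve h" "card D' = card D"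
    "graphic_closure (kept h \<union> reserve h - D') = graphic_closure (kept h \<union> reserve h - D)"
    "cost (kept h - D) D xs \<le> sum w F + cost (kept h \<union> F - D') D' (filter (\<lambda>x. x \<notin> F) xs)"
    using cost_after_reply[of D xs F "kept h"] xs R FR D awaiting_fixer(3)[OF h] by auto
  have c: "conn (kept h \<union> reserve h - D') \<longleftrightarrow> conn (kept h \<union> reserve h - D)"
    using awaiting_fixer(4)[OF h] D'(3) by simp
  have "sum w (reserve h - F) = sum w (reserve h) - sum w F"
    using R FR by (simp add: sum_diff)
  moreover have "kept h \<union> F \<union> (reserve h - F) = kept h \<union> reserve h" using FR by auto
  moreover have "kept (Fix h F) = kept h \<union> F" by (simp add: kept_def)
  ultimately show ?thesis
    unfolding attainable_def using D D' xs le c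
    by (intro exI[of _ D'] exI[of _ "filter (\<lambda>x. x \<notin> F) xs"]) (auto simp: sorted_filter cong: if_cong)
qed

text \<open>
  Once the limit is used up, the only plan that Buster can afford is the empty one.
\<close>

lemma attainable_fixer_won:
  assumes h: "h \<in> HF" "fixer_won h" and att: "attainable t h"
  shows "payout h \<le> t"
proof -
  note s = history_sound(1)[OF h(1)]
  from att obtain D xs where D: "D \<subseteq> graph h \<union> reserve h" "card D + busted h \<le> limit h"
    and xs: "set xs = reserve h"
    and le: "1 + sum w (reserve h) - cost (graph h - D) D xs
       - (if conn (graph h \<union> reserve h - D) then 0 else 2 + sum w (first_reserve h)) \<le> t"
    by (auto simp: attainable_def kept_eq_graph[OF h(1)])
  have "finite D" using D(1) s sound_reserve(1)[OF s] by (auto simp: sound_def intro: finite_subset)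
  then have "D = {}" using D(2) h(2) by (simp add: fixer_won_def)
  moreover have "conn (graph h \<union> reserve h)" using s conn_mono[of "graph h"] by (simp add: sound_def)
  moreover have "cost (graph h) {} xs = 0" using reserve_spanned[OF s] xs by (simp add: cost_spanned)
  ultimately show ?thesis using le payout_eq[OF s] h(2) by simp
qed

text \<open>
  A cycle through a reserve edge and the current graph contains no bridge of their union, so
  removing bridges leaves the reserve spanned.
\<close>

lemma reserve_spanned_without_bridges:
  assumes s: "sound h" and "finite Y"
    and bridge: "\<forall>e\<in>Y. e \<in> graph h \<and> \<not> conn (graph h \<union> reserve h - {e})"
  shows "reserve h \<subseteq> graphic_closure (graph h - Y)"
  using assms(2,3)
proof (induction Y)
  case empty
  then show ?case using reserve_spanned[OF s] by simp
next
  case (insert e Y)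
  let ?X = "graph h - insert e Y"
  have e: "e \<in> graph h" "\<not> conn (graph h \<union> reserve h - {e})" using insert.prems by auto
  have X: "insert e ?X = graph h - Y" using e insert.hyps by auto
  show ?case
  proof (rule ccontr)
    assume "\<not> reserve h \<subseteq> graphic_closure ?X"
    then obtain r where r: "r \<in> reserve h" "r \<notin> graphic_closure ?X" by auto
    have "r \<in> graphic_closure (insert e ?X)" using insert r(1) X by auto
    then have "e \<in> graphic_closure (insert r ?X)" using cl_exchange r(2) by blast
    moreover have "insert r ?X \<subseteq> graph h \<union> reserve h - {e}"
      using r(1) e(1) s by (auto simp: sound_def)
    ultimately have "e \<in> graphic_closure (graph h \<union> reserve h - {e})" using cl_mono by blast
    then have "graph h \<union> reserve h \<subseteq> graphic_closure (graph h \<union> reserve h - {e})"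
      using cl_extensive[of "graph h \<union> reserve h - {e}"] by blast
    moreover have "conn (graph h \<union> reserve h)" using s conn_mono[of "graph h"] by (simp add: sound_def)
    ultimately show False using conn_iff_closure[of "graph h \<union> reserve h"] s e(2) by (simp add: sound_def)
  qed
qed

text \<open>
  A position that Buster has just won is judged by its payout, because no plan
  can be carried out any more, although \<open>attainable\<close> might still promise further costs.
\<close>

definition secured :: "real \<Rightarrow> 'e history \<Rightarrow> bool" where
  "secured t h \<longleftrightarrow> (if game_over h then payout h \<le> t else attainable t h)"

text \<open>
  Buster follows his plan \<open>D\<close> edge by edge, preferring edges whose removal does not win at once,
  since a premature win would forgo costs that the plan still promises.  If only bridges are left,
  the plan has no cost left, and deleting one of them wins.  If no edge of \<open>D\<close> is in the graph, the
  plan promises nothing at all, and any legal move \<open>B\<^sub>0\<close> will do.  Such a move has to be supplied,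
  as on a single vertex there may be no edge to delete.
\<close>

lemma attainable_after_some_bust:
  assumes h: "h \<in> HF" "\<not> game_over h" and att: "attainable t h" and B\<^sub>0: "legal_bust h B\<^sub>0"
  shows "\<exists>B. legal_bust h B \<and> secured t (Bust h B)"
proof -
  note s = history_sound(1)[OF h(1)]
  note R = sound_reserve[OF s]
  from att obtain D xs where D: "D \<subseteq> graph h \<union> reserve h" "card D + busted h \<le> limit h"
    and xs: "distinct xs" "sorted (map w xs)" "set xs = reserve h"
    and le: "1 + sum w (reserve h) - cost (graph h - D) D xs
       - (if conn (graph h \<union> reserve h - D) then 0 else 2 + sum w (first_reserve h)) \<le> t"
    by (auto simp: attainable_def kept_eq_graph[OF h(1)])
  have finD: "finite D" using D(1) s R(1) by (auto simp: sound_def intro: finite_subset)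
  have over: "game_over (Bust h B) \<longleftrightarrow> \<not> conn (graph h - B \<union> reserve h)" for B
    by (auto simp: game_over_def fixer_won_def buster_won_def)
  have single: "legal_bust h {e}" "graph h - {e} \<union> reserve h = graph h \<union> reserve h - {e}"
    if "e \<in> D \<inter> graph h" for e
  proof -
    have "card D \<ge> 1" using that finD by (auto simp: Suc_le_eq card_gt_0_iff)
    then show "legal_bust h {e}" using that D(2) by (auto simp: legal_bust_def)
    show "graph h - {e} \<union> reserve h = graph h \<union> reserve h - {e}"
      using that s by (auto simp: sound_def)
  qed
  have lost: "payout (Bust h B) = 1 + sum w (reserve h) - (2 + sum w (first_reserve h))"
    if "legal_bust h B" for B
  proof -
    have "Bust h B \<in> HB" using h that by (auto intro: HF_HB.intros simp: game_over_def)
    from payout_eq[OF history_sound(2)[OF this]] show ?thesis by (simp add: fixer_won_def)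
  qed
  consider (safe) e where "e \<in> D \<inter> graph h" "conn (graph h \<union> reserve h - {e})"
    | (bridge) e where "e \<in> D \<inter> graph h" "\<forall>e\<in>D \<inter> graph h. \<not> conn (graph h \<union> reserve h - {e})"
    | (none) "D \<inter> graph h = {}"
    by blast
  then show ?thesis
  proof cases
    case safe
    have eD: "e \<in> D" "e \<notin> reserve h" using safe s by (auto simp: sound_def)
    have "D \<inter> set xs = (D - {e}) \<inter> set xs" using eD xs by auto
    moreover have "graph h - D = graph h - {e} - (D - {e})" using eD by auto
    ultimately have "cost (graph h - D) D xs = cost (graph h - {e} - (D - {e})) (D - {e}) xs"
      using cost_deleted_cong[of D xs "D - {e}"] by simp
    moreover have "graph h - {e} \<union> reserve h - (D - {e}) = graph h \<union> reserve h - D"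
      using eD by auto
    moreover have "card (D - {e}) + 1 = card D" using card.remove[OF finD eD(1)] by simp
    ultimately have "attainable t (Bust h {e})"
      unfolding attainable_def using D xs le eD
      by (intro exI[of _ "D - {e}"] exI[of _ xs]) (auto simp: kept_def cong: if_cong)
    then show ?thesis using single[OF safe(1)] safe(2) over[of "{e}"] by (intro exI[of _ "{e}"]) (simp add: secured_def)
  next
    case bridge
    have "reserve h \<subseteq> graphic_closure (graph h - D \<inter> graph h)"
      using bridge(2) finD by (intro reserve_spanned_without_bridges[OF s]) auto
    moreover have "graph h - D \<inter> graph h = graph h - D" by auto
    ultimately have "cost (graph h - D) D xs = 0" using xs(3) by (simp add: cost_spanned)
    then have "payout (Bust h {e}) \<le> t"
      using le lost[OF single(1)[OF bridge(1)]] R(3) by (auto split: if_splits)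
    then show ?thesis using single[OF bridge(1)] bridge over[of "{e}"] by (intro exI[of _ "{e}"]) (simp add: secured_def)
  next
    case none
    have "graph h - D = graph h" using none by auto
    then have "cost (graph h - D) D xs = 0" using reserve_spanned[OF s] xs(3) by (simp add: cost_spanned)
    moreover have "graph h \<subseteq> graph h \<union> reserve h - D" using none by auto
    then have "conn (graph h \<union> reserve h - D)" using conn_mono s by (auto simp: sound_def)
    ultimately have t: "1 + sum w (reserve h) \<le> t" using le by simp
    show ?thesis
    proof (cases "game_over (Bust h B\<^sub>0)")
      case True
      then show ?thesis using t lost[OF B\<^sub>0] R(3) B\<^sub>0 by (intro exI[of _ B\<^sub>0]) (simp add: secured_def)
    next
      case False
      have "0 \<le> cost (graph h - B\<^sub>0) {} xs" using xs(3) R(2) by (intro cost_nonneg) simp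
      then have "attainable t (Bust h B\<^sub>0)"
        unfolding attainable_def using t xs B\<^sub>0 False over[of B\<^sub>0]
        by (intro exI[of _ "{}"] exI[of _ xs]) (auto simp: kept_def legal_bust_def)
      then show ?thesis using False B\<^sub>0 by (intro exI[of _ B\<^sub>0]) (simp add: secured_def)
    qed
  qed
qed

section \<open>Playing out the game\<close>

lemma play_invariant:
  assumes \<beta>: "buster_strategy \<beta>" and \<phi>: "fixer_strategy \<phi>" and h: "h \<in> HF \<union> HB" "P h"
    and step: "\<And>s. s \<in> HF \<union> HB \<Longrightarrow> \<not> game_over s \<Longrightarrow> P s \<Longrightarrow> P (move \<beta> \<phi> s)"
  shows "P (play \<beta> \<phi> h)"
  unfolding play_def
proof (rule while_rule[where P = "\<lambda>h. h \<in> HF \<union> HB \<and> P h" and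
      r = "measure (\<lambda>h. 2 * (limit h - busted h) + (if ends_with_bust h then 1 else 0))"])
  fix s assume s: "s \<in> HF \<union> HB \<and> P s" "\<not> game_over s"
  then show "move \<beta> \<phi> s \<in> HF \<union> HB \<and> P (move \<beta> \<phi> s)" using move_history[OF \<beta> \<phi>] step by blast
  show "(move \<beta> \<phi> s, s) \<in>
    measure (\<lambda>h. 2 * (limit h - busted h) + (if ends_with_bust h then 1 else 0))"
  proof (cases "ends_with_bust s")
    case False
    with s have "s \<in> HF" using history_kind(2) by blast
    then have B: "legal_bust s (\<beta> s)" using s \<beta> by (auto simp: buster_strategy_def)
    then have "card (\<beta> s) > 0"
      using finite_graph(1)[OF \<open>s \<in> HF\<close>] unfolding legal_bust_def by (metis card_gt_0_iff finite_subset)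
    then show ?thesis using False B by (auto simp: move_def legal_bust_def)
  qed (simp add: move_def)
qed (use h in auto)

text \<open>
  The final payout is attainable at the end of the play, and attainability is passed backwards
  through the moves of Buster and the cheapest replies.
\<close>

lemma attainable_from_greedy_play:
  assumes \<beta>: "buster_strategy \<beta>" and \<phi>: "fixer_strategy \<phi>" "greedy \<phi>" and h: "h \<in> HF \<union> HB"
  shows "attainable (payout (play \<beta> \<phi> h)) h"
proof -
  have "\<forall>t. attainable t (play \<beta> \<phi> h) \<longrightarrow> attainable t h"
  proof (rule play_invariant[OF \<beta> \<phi>(1) h])
    fix s assume s: "s \<in> HF \<union> HB" "\<not> game_over s" "\<forall>t. attainable t s \<longrightarrow> attainable t h"
    have "attainable t s" if "attainable t (move \<beta> \<phi> s)" for t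
    proof (cases "ends_with_bust s")
      case True
      then have "s \<in> HB" using s(1) history_kind(1) by blast
      then show ?thesis
        using attainable_before_greedy_fix[OF \<phi> _ s(2)] that True by (simp add: move_def)
    next
      case False
      then have "s \<in> HF" using s(1) history_kind(2) by blast
      then show ?thesis
        using attainable_before_bust[of s "\<beta> s"] \<beta> s(2) that False
        by (simp add: move_def buster_strategy_def)
    qed
    then show "\<forall>t. attainable t (move \<beta> \<phi> s) \<longrightarrow> attainable t h" using s(3) by blast
  qed simp
  then show ?thesis using complete_attainable[OF complete_history_play[OF \<beta> \<phi>(1) h]] by blast
qed

text \<open>
  The Buster strategy that keeps \<open>t\<close> secured wherever it is attainable; elsewhere it copies \<open>\<beta>\<close>,
  just to be legal at all histories.
\<close>

definition pressing :: "real \<Rightarrow> ('e history \<Rightarrow> 'e set) \<Rightarrow> 'e history \<Rightarrow> 'e set" where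
  "pressing t \<beta> h =
     (if attainable t h then SOME B. legal_bust h B \<and> secured t (Bust h B) else \<beta> h)"

lemma pressing:
  assumes \<beta>: "buster_strategy \<beta>" and h: "h \<in> HF" "\<not> game_over h"
  shows "legal_bust h (pressing t \<beta> h)"
    "attainable t h \<Longrightarrow> secured t (Bust h (pressing t \<beta> h))"
proof -
  have B: "legal_bust h (\<beta> h)" using \<beta> h by (simp add: buster_strategy_def)
  have *: "legal_bust h (pressing t \<beta> h) \<and> secured t (Bust h (pressing t \<beta> h))" if "attainable t h"
    using someI_ex[OF attainable_after_some_bust[OF h that B]] that by (simp add: pressing_def)
  show "legal_bust h (pressing t \<beta> h)"
    using * B by (cases "attainable t h") (auto simp: pressing_def)
  show "attainable t h \<Longrightarrow> secured t (Bust h (pressing t \<beta> h))"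
    using * by blast
qed

lemma pressing_play:
  assumes \<beta>: "buster_strategy \<beta>" and \<phi>: "fixer_strategy \<phi>" and h: "h \<in> HB" "\<not> game_over h"
    and att: "attainable t h"
  shows "payout (play (pressing t \<beta>) \<phi> h) \<le> t"
proof -
  let ?\<beta> = "pressing t \<beta>"
  have strategy: "buster_strategy ?\<beta>" using pressing(1)[OF \<beta>] by (auto simp: buster_strategy_def)
  have hist: "h \<in> HF \<union> HB" using h by simp
  have "secured t (play ?\<beta> \<phi> h)"
  proof (rule play_invariant[OF strategy \<phi> hist])
    show "secured t h" using h att by (simp add: secured_def)
    fix s assume s: "s \<in> HF \<union> HB" "\<not> game_over s" "secured t s"
    then have att: "attainable t s" by (simp add: secured_def)
    show "secured t (move ?\<beta> \<phi> s)"
    proof (cases "ends_with_bust s")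
      case True
      then have sB: "s \<in> HB" using s(1) history_kind(1) by blast
      then have F: "legal_fix s (\<phi> s)" using \<phi> s(2) by (simp add: fixer_strategy_def)
      then have next_HF: "Fix s (\<phi> s) \<in> HF"
        using sB s(2) by (auto intro: HF_HB.intros simp: game_over_def)
      have "game_over (Fix s (\<phi> s)) \<Longrightarrow> fixer_won (Fix s (\<phi> s))"
        by (simp add: game_over_def buster_won_def)
      then show ?thesis
        using attainable_after_fix[OF sB s(2) F att] attainable_fixer_won[OF next_HF] True
        by (simp add: move_def secured_def)
    next
      case False
      then have "s \<in> HF" using s(1) history_kind(2) by blast
      then show ?thesis using pressing(2)[OF \<beta> _ s(2) att] False by (simp add: move_def)
    qed
  qed
  then show ?thesis
    using complete_history_play[OF strategy \<phi> hist] by (simp add: complete_history_def secured_def)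
qed

lemma play_start:
  assumes \<beta>: "buster_strategy \<beta>" and \<phi>: "fixer_strategy \<phi>" and h: "h \<in> HF \<union> HB"
  shows "limit (play \<beta> \<phi> h) = limit h \<and> first_graph (play \<beta> \<phi> h) = first_graph h \<and>
    first_reserve (play \<beta> \<phi> h) = first_reserve h"
  by (rule play_invariant[OF \<beta> \<phi> h]) (simp_all add: move_def)

lemma greedy_dominant:
  assumes \<phi>: "fixer_strategy \<phi>" "greedy \<phi>" and h: "h \<in> HB"
  shows "fixer_dominant \<phi> h"
  unfolding fixer_dominant_def fixer_dominates_def
proof (intro allI impI, elim conjE)
  fix \<phi>' \<beta> assume \<phi>': "fixer_strategy \<phi>'" and \<beta>: "buster_strategy \<beta>"
  have hist: "h \<in> HF \<union> HB" using h by simp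
  let ?t = "payout (play \<beta> \<phi> h)"
  have "\<exists>\<beta>'. buster_strategy \<beta>' \<and> payout (play \<beta>' \<phi>' h) \<le> ?t"
  proof (cases "game_over h")
    case True
    then have "play \<beta> \<chi> h = h" for \<chi> by (simp add: play_def while_unfold)
    then show ?thesis using \<beta> by auto
  next
    case False
    have "buster_strategy (pressing ?t \<beta>)"
      using pressing(1)[OF \<beta>] by (auto simp: buster_strategy_def)
    then show ?thesis
      using pressing_play[OF \<beta> \<phi>' h False] attainable_from_greedy_play[OF \<beta> \<phi> hist] by blast
  qed
  then show "\<exists>\<beta>'. buster_strategy \<beta>' \<and> fixer_superior (play \<beta> \<phi> h) (play \<beta>' \<phi>' h)"
    using play_start[OF _ _ hist] complete_history_play[OF _ _ hist] \<beta> \<phi>(1) \<phi>'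
    unfolding fixer_superior_def by metis
qed

end

theorem theorem1p1:
  fixes V :: "'v set" and ends :: "'e \<Rightarrow> 'v set" and w :: "'e \<Rightarrow> real"
    and \<phi> :: "'e history \<Rightarrow> 'e set" and h :: "'e history"
  assumes "buster_fixer V"
    and "buster_fixer.fixer_strategy V ends w \<phi>"
    and "buster_fixer.greedy V ends w \<phi>"
    and "h \<in> buster_fixer.HB V ends w"
  shows "buster_fixer.fixer_dominant V ends w \<phi> h"
  using buster_fixer.greedy_dominant[OF assms] .

end
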